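(* Let $d$ be a positive integer, and let $w_1\ge w_2\ge\ldots\ge w_n$ be positive numbers such that $$w_1+w_2+\ldots+w_n\ge 3d\log(2/w_n).$$ Then any sequence of slabs $S_1,\ldots,S_n\subset\mathbb{R}^d$ with widths $w_1,\ldots,w_n$, respectively, permits a translative covering of a $d$-dimensional ball of diameter $1-w_n/2$.
   Context: A slab of width $w>0$ in $\mathbb{R}^d$ is the closed set of points lying between two parallel hyperplanes at distance $w$ from each other, i.e. a set of the form $\{\mathbf{x}\in\mathbb{R}^d: b\le\langle\mathbf{v},\mathbf{x}\rangle\le b+w\}$ with $\mathbf{v}$ a unit vector and $b\in\mathbb{R}$. A sequence of slabs $S_1,\ldots,S_n$ permits a translative covering of a set $C\subseteq\mathbb{R}^d$ if there are translates $S_i'$ of $S_i$ ($i=1,\ldots,n$) such that $\bigcup_{i} S_i'\supseteq C$. Here $\log$ is the natural logarithm. *)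

theory Defs
  imports "HOL-Analysis.Analysis"
begin

definition is_slab :: "real \<Rightarrow> 'a::euclidean_space set \<Rightarrow> bool" where
  "is_slab w S \<longleftrightarrow> w > 0 \<and>
     (\<exists>v b. norm v = 1 \<and> S = {x. b \<le> v \<bullet> x \<and> v \<bullet> x \<le> b + w})"

(* Sequences of length n are indexed by {1..n}; values of S outside this range are irrelevant. *)
definition permits_translative_covering ::
    "nat \<Rightarrow> (nat \<Rightarrow> 'a::euclidean_space set) \<Rightarrow> 'a set \<Rightarrow> bool" where
  "permits_translative_covering n S C \<longleftrightarrow>
     (\<exists>t. C \<subseteq> (\<Union>i\<in>{1..n}. (\<lambda>x. t i + x) ` S i))"

end

theory Submission
  imports Defs
begin

text \<open>
  Shrink every slab by \<open>w\<^sub>n/4\<close> on both sides and place the shrunken slabs greedily in a ball of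
  diameter 1. Finitely many parallel translates of a slab of width \<open>u\<close> cover the ball, at most
  \<open>1 + 1/u\<close> of them being needed, so some translate reduces the uncovered volume at least by the
  factor \<open>1/(1+u)\<close>. The hypothesis on the total width makes the volume left at the end smaller
  than that of a ball of radius \<open>w\<^sub>n/4\<close>. A point missed by the original slabs would be the centre
  of such a ball missed by the shrunken ones.
\<close>

text \<open>Normal and offset are explicit, so that moving a slab along a unit normal
  \<open>v\<close> changes \<open>b\<close> alone.\<close>

definition slab :: "'a::euclidean_space \<Rightarrow> real \<Rightarrow> real \<Rightarrow> 'a set" where
  "slab v b w = {x. b \<le> v \<bullet> x \<and> v \<bullet> x \<le> b + w}"

lemma closed_slab: "closed (slab v b w)"
  unfolding slab_def
  by (intro closed_Collect_conj closed_Collect_le continuous_intros)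

lemma lmeasurable_Diff_UN_slabs:
  assumes "finite I" and "A \<in> lmeasurable"
  shows "A - (\<Union>i\<in>I. slab (v i) (b i) (w i)) \<in> lmeasurable"
proof -
  have "closed (\<Union>i\<in>I. slab (v i) (b i) (w i))"
    using assms(1) closed_slab by (intro closed_UN) auto
  then show ?thesis
    using assms(2) by (intro fmeasurable_Diff) (auto intro: borel_closed)
qed

lemma slab_translate:
  assumes "norm v = 1"
  shows "(\<lambda>x. a *\<^sub>R v + x) ` slab v b w = slab v (b + a) w"
proof -
  have vv: "v \<bullet> v = 1"
    using assms by (simp add: norm_eq_1)
  have "x \<in> (\<lambda>x. a *\<^sub>R v + x) ` slab v b w" if "x \<in> slab v (b + a) w" for x
  proof (rule image_eqI)
    show "x - a *\<^sub>R v \<in> slab v b w"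
      using that by (auto simp: slab_def inner_diff_right vv)
  qed simp
  then show ?thesis
    by (auto simp: slab_def inner_add_right vv)
qed

text \<open>Cauchy-Schwarz bounds the width of the ball in direction \<open>v\<close> by its
  diameter.\<close>

lemma cball_subset_slab:
  assumes "norm v = 1" and "w \<ge> 2 * r"
  shows "cball c r \<subseteq> slab v (v \<bullet> c - r) w"
proof
  fix x assume "x \<in> cball c r"
  then have "norm (x - c) \<le> r"
    by (simp add: dist_norm norm_minus_commute)
  moreover have "\<bar>v \<bullet> (x - c)\<bar> \<le> norm (x - c)"
    using Cauchy_Schwarz_ineq2[of v "x - c"] assms(1) by simp
  ultimately show "x \<in> slab v (v \<bullet> c - r) w"
    using assms(2) by (auto simp: slab_def inner_diff_right)
qed

lemma slab_subset_UN_slabs: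
  assumes "u > 0" and "real k * u \<ge> w" and "k > 0"
  shows "slab v b w \<subseteq> (\<Union>j<k. slab v (b + real j * u) u)"
proof
  fix x assume "x \<in> slab v b w"
  then have x: "0 \<le> v \<bullet> x - b" "v \<bullet> x - b \<le> real k * u"
    using assms(2) by (auto simp: slab_def)
  define m where "m = nat \<lfloor>(v \<bullet> x - b) / u\<rfloor>"
  have m: "real m * u \<le> v \<bullet> x - b" "v \<bullet> x - b < (real m + 1) * u"
  proof -
    have "real m = of_int \<lfloor>(v \<bullet> x - b) / u\<rfloor>"
      using x(1) assms(1) by (simp add: m_def)
    then have "real m \<le> (v \<bullet> x - b) / u" "(v \<bullet> x - b) / u < real m + 1"
      by linarith+
    then show "real m * u \<le> v \<bullet> x - b" "v \<bullet> x - b < (real m + 1) * u"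
      using assms(1) by (simp_all add: field_simps)
  qed
  show "x \<in> (\<Union>j<k. slab v (b + real j * u) u)"
  proof (cases "m < k")
    case True
    then show ?thesis
      using m by (intro UN_I[of m]) (auto simp: slab_def algebra_simps)
  next
    case False
    then have "real k * u \<le> real m * u"
      using assms(1) by simp
    then have "v \<bullet> x - b = real k * u"
      using m x by linarith
    then show ?thesis
      using assms(1,3)
      by (intro UN_I[of "k - 1"]) (auto simp: slab_def algebra_simps)
  qed
qed

text \<open>Pigeonhole: if \<open>k\<close> parallel translates cover \<open>A\<close>, one of them
  contains at least the share \<open>1 / k\<close> of its measure.\<close>

lemma exists_slab_reducing_measure:
  fixes A :: "'a::euclidean_space set"
  assumes "norm v = 1" and "u > 0" and "A \<in> lmeasurable" and "A \<subseteq> cball c (1/2)"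
  shows "\<exists>b. measure lebesgue (A - slab v b u) \<le> measure lebesgue A / (1 + u)"
proof -
  \<comment> \<open>Rounding \<open>1 / u\<close> up gives \<open>k * u \<ge> 1\<close>, enough to
    fill a slab of width 1 around the ball, and \<open>k * u < 1 + u\<close>, which makes the share
    \<open>1 / k\<close> at least \<open>u / (1 + u)\<close>.\<close>
  define k where "k = nat \<lceil>1 / u\<rceil>"
  have "real k = of_int \<lceil>1 / u\<rceil>"
    using assms(2) by (simp add: k_def)
  then have "1 / u \<le> real k" "real k < 1 / u + 1"
    by linarith+
  then have k: "real k * u \<ge> 1" "real k * u < 1 + u"
    using assms(2) by (simp_all add: field_simps)
  have k0: "k > 0"
    using k(1) by (cases k) auto
  define T where "T j = slab v (v \<bullet> c - 1/2 + real j * u) u" for j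
  have T: "A \<inter> T j \<in> lmeasurable" for j
    unfolding T_def
    by (intro fmeasurable_Int_fmeasurable assms(3)) (auto intro!: borel_closed closed_slab)
  have "A \<subseteq> (\<Union>j<k. T j)"
    using assms(4) cball_subset_slab[OF assms(1), of "1/2" 1 c]
      slab_subset_UN_slabs[OF assms(2) k(1) k0, of v "v \<bullet> c - 1/2"]
    unfolding T_def by auto
  then have "A = (\<Union>j<k. A \<inter> T j)"
    by blast
  then have sum: "measure lebesgue A \<le> (\<Sum>j<k. measure lebesgue (A \<inter> T j))"
    using measure_UNION_le[of "{..<k}" "\<lambda>j. A \<inter> T j" lebesgue] T
    by (metis finite_lessThan fmeasurableD)
  have "\<exists>j<k. measure lebesgue A / k \<le> measure lebesgue (A \<inter> T j)"
  proof (rule ccontr)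
    assume "\<not> ?thesis"
    then have "(\<Sum>j<k. measure lebesgue (A \<inter> T j)) < (\<Sum>j<k. measure lebesgue A / k)"
      using k0 by (intro sum_strict_mono) auto
    then show False
      using sum k0 by simp
  qed
  then obtain j where j: "measure lebesgue A / k \<le> measure lebesgue (A \<inter> T j)"
    by blast
  have "u / (1 + u) \<le> 1 / k"
    using k k0 assms(2) by (simp add: field_simps)
  then have "measure lebesgue A * (u / (1 + u)) \<le> measure lebesgue A * (1 / k)"
    by (intro mult_left_mono) auto
  then have "measure lebesgue A * (u / (1 + u)) \<le> measure lebesgue (A \<inter> T j)"
    using j by simp
  moreover have "measure lebesgue (A - T j) = measure lebesgue A - measure lebesgue (A \<inter> T j)"
    using measurable_measure_Diff[OF assms(3), of "A \<inter> T j"] T[of j]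
    by (simp add: Diff_Int fmeasurableD)
  moreover have "measure lebesgue A - measure lebesgue A * (u / (1 + u)) = measure lebesgue A / (1 + u)"
    using assms(2) by (simp add: field_simps)
  ultimately show ?thesis
    unfolding T_def by (metis diff_left_mono)
qed

text \<open>Greedy choice: each new slab is placed against the set \<open>A\<close> that the earlier
  ones leave uncovered, so the factors multiply whatever the directions are.\<close>

lemma exists_slabs_leaving_small_measure:
  fixes v :: "nat \<Rightarrow> 'a::euclidean_space"
  assumes "\<And>i. i \<in> {1..n} \<Longrightarrow> norm (v i) = 1" and "\<And>i. i \<in> {1..n} \<Longrightarrow> u i > 0"
  shows "\<exists>b. measure lebesgue (cball c (1/2) - (\<Union>i\<in>{1..n}. slab (v i) (b i) (u i)))
           \<le> measure lebesgue (cball c (1/2)) / (\<Prod>i=1..n. 1 + u i)"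
  using assms
proof (induction n)
  case 0
  then show ?case by simp
next
  case (Suc n)
  then obtain b where b: "measure lebesgue (cball c (1/2) - (\<Union>i\<in>{1..n}. slab (v i) (b i) (u i)))
           \<le> measure lebesgue (cball c (1/2)) / (\<Prod>i=1..n. 1 + u i)"
    by (metis atLeastAtMost_iff le_SucI)
  define A where "A = cball c (1/2) - (\<Union>i\<in>{1..n}. slab (v i) (b i) (u i))"
  have "A \<in> lmeasurable"
    unfolding A_def
    by (intro lmeasurable_Diff_UN_slabs lmeasurable_cball) simp
  then obtain \<beta> where \<beta>:
    "measure lebesgue (A - slab (v (Suc n)) \<beta> (u (Suc n))) \<le> measure lebesgue A / (1 + u (Suc n))"
    using exists_slab_reducing_measure[of "v (Suc n)" "u (Suc n)" A c] Suc.prems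
    by (auto simp: A_def)
  let ?b = "b(Suc n := \<beta>)"
  have "cball c (1/2) - (\<Union>i\<in>{1..Suc n}. slab (v i) (?b i) (u i)) = A - slab (v (Suc n)) \<beta> (u (Suc n))"
    by (auto simp: A_def atLeastAtMostSuc_conv)
  moreover have "measure lebesgue A / (1 + u (Suc n))
      \<le> measure lebesgue (cball c (1/2)) / (\<Prod>i=1..n. 1 + u i) / (1 + u (Suc n))"
    using b Suc.prems(2)[of "Suc n"] by (intro divide_right_mono) (auto simp: A_def)
  ultimately show ?case
    using \<beta> by (intro exI[of _ ?b]) (simp add: mult.commute)
qed

text \<open>This is the source of the constant 3: a slab that keeps at least half its width
  \<open>x\<close> contributes a factor of at least \<open>1 + x / 2\<close>, and this has to beat
  \<open>exp (x / 3)\<close>. The quadratic bound on \<open>exp\<close> suffices, as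
  \<open>x\<^sup>2 / 9 < x / 6\<close>.\<close>

lemma exp_third_less:
  fixes x :: real
  assumes "0 < x" and "x < 1"
  shows "exp (x / 3) < 1 + x / 2"
proof -
  have sq: "x * x < x * 1"
    using assms by (intro mult_strict_left_mono) auto
  have "exp (x / 3) \<le> 1 + x / 3 + (x / 3)\<^sup>2"
    using assms by (intro exp_bound) auto
  also have "1 + x / 3 + (x / 3)\<^sup>2 < 1 + x / 2"
    using assms sq by (simp add: power2_eq_square field_simps)
  finally show ?thesis .
qed

text \<open>The case of widths below 1, where \<open>exp_third_less\<close> applies;
  \<open>e\<close> stands for the smallest width.\<close>

lemma cball_subset_slabs:
  fixes v :: "nat \<Rightarrow> 'a::euclidean_space"
  assumes "n \<ge> 1"
    and v: "\<And>i. i \<in> {1..n} \<Longrightarrow> norm (v i) = 1"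
    and e: "e > 0" "\<And>i. i \<in> {1..n} \<Longrightarrow> e \<le> w i"
    and w1: "\<And>i. i \<in> {1..n} \<Longrightarrow> w i < 1"
    and sum: "(\<Sum>i=1..n. w i) \<ge> 3 * real DIM('a) * ln (2 / e)"
  shows "\<exists>b. cball c ((1 - e / 2) / 2) \<subseteq> (\<Union>i\<in>{1..n}. slab (v i) (b i) (w i))"
proof -
  \<comment> \<open>A loss of \<open>e / 4\<close> on each side costs at most half of the width,
    because \<open>e \<le> w i\<close>.\<close>
  define u where "u i = w i - e / 2" for i
  define P where "P = (\<Prod>i=1..n. 1 + u i)"
  have w0: "w i > 0" if "i \<in> {1..n}" for i
    using e(1) e(2)[OF that] by linarith
  have u: "u i > 0" "w i / 2 \<le> u i" if "i \<in> {1..n}" for i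
    using e(1) e(2)[OF that] by (auto simp: u_def)
  \<comment> \<open>The hypothesis on the total width, divided by 3 and exponentiated.\<close>
  have P: "(2 / e) ^ DIM('a) < P"
  proof -
    have "(2 / e) ^ DIM('a) = exp (real DIM('a) * ln (2 / e))"
      using e(1) by (simp add: exp_of_nat_mult)
    also have "\<dots> \<le> exp (\<Sum>i=1..n. w i / 3)"
      using sum by (simp flip: sum_divide_distrib)
    also have "\<dots> = (\<Prod>i=1..n. exp (w i / 3))"
      by (simp add: exp_sum)
    also have "\<dots> < P"
      unfolding P_def
    proof (rule prod_mono_strict)
      have lt: "exp (w i / 3) < 1 + u i" if "i \<in> {1..n}" for i
        using exp_third_less[OF w0[OF that] w1[OF that]] u[OF that] by linarith
      \<comment> \<open>Strictness of the product needs one strict factor; index 1 exists since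
        \<open>n \<ge> 1\<close>.\<close>
      show "exp (w 1 / 3) < 1 + u 1"
        using lt assms(1) by simp
      show "0 \<le> exp (w i / 3) \<and> exp (w i / 3) \<le> 1 + u i" if "i \<in> {1..n}" for i
        using lt[OF that] by simp
      show "0 < 1 + u i" if "i \<in> {1..n}" for i
        using u(1)[OF that] by simp
    qed (use assms(1) in auto)
    finally show ?thesis .
  qed
  obtain b where b: "measure lebesgue (cball c (1/2) - (\<Union>i\<in>{1..n}. slab (v i) (b i) (u i)))
      \<le> measure lebesgue (cball c (1/2)) / P"
    using exists_slabs_leaving_small_measure[of n v u c] v u unfolding P_def by blast
  define R where "R = cball c (1/2) - (\<Union>i\<in>{1..n}. slab (v i) (b i) (u i))"
  have R: "R \<in> lmeasurable"
    unfolding R_def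
    by (intro lmeasurable_Diff_UN_slabs lmeasurable_cball) simp
  \<comment> \<open>Offset \<open>b i - e / 4\<close> with width \<open>w i\<close> is the shrunken
    slab thickened again by \<open>e / 4\<close> on both sides.\<close>
  have "p \<in> (\<Union>i\<in>{1..n}. slab (v i) (b i - e / 4) (w i))" if p: "p \<in> cball c ((1 - e / 2) / 2)" for p
  proof (rule ccontr)
    assume np: "p \<notin> (\<Union>i\<in>{1..n}. slab (v i) (b i - e / 4) (w i))"
    \<comment> \<open>The radii \<open>1/2 - e / 4\<close> and \<open>e / 4\<close> add up to 1/2,
      and a move by at most \<open>e / 4\<close> cannot lead from outside a thickened slab into the
      shrunken one.\<close>
    have "q \<in> R" if q: "q \<in> cball p (e / 4)" for q
    proof -
      have "dist c q \<le> 1/2"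
        using p q dist_triangle[of c q p] by simp
      moreover have "q \<notin> slab (v i) (b i) (u i)" if i: "i \<in> {1..n}" for i
      proof
        assume "q \<in> slab (v i) (b i) (u i)"
        moreover have "\<bar>v i \<bullet> (p - q)\<bar> \<le> e / 4"
          using Cauchy_Schwarz_ineq2[of "v i" "p - q"] v[OF i] q by (simp add: dist_norm)
        ultimately have "p \<in> slab (v i) (b i - e / 4) (w i)"
          unfolding slab_def u_def mem_Collect_eq inner_diff_right by linarith
        with np i show False by blast
      qed
      ultimately show ?thesis
        by (auto simp: R_def)
    qed
    then have "measure lebesgue (cball p (e / 4)) \<le> measure lebesgue R"
      by (intro measure_mono_fmeasurable R) auto
    then have "measure lebesgue (cball p (e / 4)) \<le> measure lebesgue (cball c (1/2)) / P"
      using b by (simp add: R_def)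
    then have "unit_ball_vol DIM('a) * (e / 4) ^ DIM('a)
        \<le> unit_ball_vol DIM('a) * ((1/2) ^ DIM('a) / P)"
      using e(1) by (simp add: content_cball)
    then have "(e / 4) ^ DIM('a) \<le> (1/2) ^ DIM('a) / P"
      by (rule mult_left_le_imp_le) simp
    moreover have "P > 0"
      using P e(1) by (smt (verit) zero_less_power divide_pos_pos)
    ultimately have "(e / 4) ^ DIM('a) * P \<le> (1/2) ^ DIM('a)"
      by (simp add: field_simps)
    \<comment> \<open>Since \<open>(e / 4) * (2 / e) = 1/2\<close>, the strict bound on
      \<open>P\<close> contradicts the volume comparison.\<close>
    moreover have "(e / 4) ^ DIM('a) * (2 / e) ^ DIM('a) = (1/2) ^ DIM('a)"
      using e(1) by (simp flip: power_mult_distrib)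
    moreover have "(e / 4) ^ DIM('a) * (2 / e) ^ DIM('a) < (e / 4) ^ DIM('a) * P"
      using P e(1) by (intro mult_strict_left_mono) auto
    ultimately show False by linarith
  qed
  then show ?thesis
    by (intro exI[of _ "\<lambda>i. b i - e / 4"]) blast
qed

theorem theorem2:
  fixes n :: nat and w :: "nat \<Rightarrow> real"
    and S :: "nat \<Rightarrow> (real ^ 'd) set" and c :: "real ^ 'd"
  assumes "n \<ge> 1"
    and "\<And>i. i \<in> {1..n} \<Longrightarrow> w i > 0"
    and "\<And>i j. i \<in> {1..n} \<Longrightarrow> j \<in> {1..n} \<Longrightarrow> i \<le> j \<Longrightarrow> w j \<le> w i"
    and "(\<Sum>i=1..n. w i) \<ge> 3 * real CARD('d) * ln (2 / w n)"
    and "\<And>i. i \<in> {1..n} \<Longrightarrow> is_slab (w i) (S i)"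
  shows "permits_translative_covering n S (cball c ((1 - w n / 2) / 2))"
proof -
  obtain v b where vb: "\<And>i. i \<in> {1..n} \<Longrightarrow> norm (v i) = 1 \<and> S i = slab (v i) (b i) (w i)"
  proof -
    have "\<forall>i. \<exists>v b. i \<in> {1..n} \<longrightarrow> norm v = 1 \<and> S i = slab v b (w i)"
      using assms(5) unfolding is_slab_def slab_def by blast
    then show thesis
      using that by metis
  qed
  have "\<exists>b'. cball c ((1 - w n / 2) / 2) \<subseteq> (\<Union>i\<in>{1..n}. slab (v i) (b' i) (w i))"
  \<comment> \<open>As \<open>w 1\<close> is the largest width, either all widths are below 1 or the
    first slab alone is wide enough for the ball, whose diameter is less than 1.\<close>
  proof (cases "w 1 < 1")
    case True
    show ?thesis
    proof (rule cball_subset_slabs)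
      show "w i < 1" if "i \<in> {1..n}" for i
        using assms(3)[of 1 i] that True by auto
    qed (use assms vb in auto)
  next
    case False
    have "w n > 0"
      using assms(1,2) by simp
    then have "cball c ((1 - w n / 2) / 2) \<subseteq> slab (v 1) (v 1 \<bullet> c - (1 - w n / 2) / 2) (w 1)"
      using False assms(1) vb by (intro cball_subset_slab) auto
    \<comment> \<open>Only the offset at index 1 matters here, so a constant function
      serves.\<close>
    then show ?thesis
      using assms(1) by (intro exI[of _ "\<lambda>i. v 1 \<bullet> c - (1 - w n / 2) / 2"]) force
  qed
  then obtain b' where "cball c ((1 - w n / 2) / 2) \<subseteq> (\<Union>i\<in>{1..n}. slab (v i) (b' i) (w i))"
    by blast
  \<comment> \<open>Each new offset is realised by a translation along the normal.\<close>
  also have "\<dots> = (\<Union>i\<in>{1..n}. (\<lambda>x. (b' i - b i) *\<^sub>R v i + x) ` S i)"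
    using vb by (intro SUP_cong) (auto simp: slab_translate)
  finally show ?thesis
    unfolding permits_translative_covering_def
    by (rule exI[where x = "\<lambda>i. (b' i - b i) *\<^sub>R v i"])
qed

end
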